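(* (a) Let $s\ge 1$ be an integer, $r$ an odd positive integer, and $p>2s+r$ a prime. Then $$\sum_{j=1}^{p-1}\frac{(H_j^{(s)})^2}{j^{r}}\equiv (-1)^{s+r}\binom{2s+r}{s}\frac{B_{p-2s-r}}{2s+r}\pmod p.$$ (b) For every integer $s\ge 1$ and any prime $p\ge 3$ such that $p-1$ does not divide $3s$ (in particular, when $p\ge 3s+3$), $$\sum_{j=1}^{p-1}\frac{(H_j^{(s)})^2}{j^{s}}\equiv \binom{3s}{s}\frac{B_{p-3s}}{3s}\pmod p.$$ (c) Moreover, under the hypotheses of (b), when $s$ is even, $$\sum_{j=1}^{p-1}\frac{(H_j^{(s)})^2}{j^{s}}\equiv 0\pmod p.$$
   Context: For positive integers $s$ and $n\ge 0$, $H_n^{(s)}=\sum_{k=1}^{n}\frac{1}{k^s}$. $(B_n)_{n\in\mathbb{N}}$ is the sequence of Bernoulli numbers. Congruences modulo $p$ are between rational numbers whose denominators are prime to $p$.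
   Formalization: Part (b) is stated under the additional condition 3s ≤ p, because B_{p-3s} has a negative index and is undefined when 3s > p; part (c) is stated without this condition. *)

theory Defs
  imports Complex_Main "HOL-Number_Theory.Number_Theory"
begin

definition gen_harm :: "nat \<Rightarrow> nat \<Rightarrow> rat" where
  "gen_harm s n = (\<Sum>k=1..n. 1 / of_nat k ^ s)"

(* The recurrence solves (\<Sum>k\<le>n. ((n + 1) choose k) * B_k) = 0 (n \<ge> 1) for B_n, that is,
   B_n / n! is the n-th Taylor coefficient of t / (exp t - 1); in particular B_1 = -1/2. *)
fun bernoulli_num :: "nat \<Rightarrow> rat" where
  "bernoulli_num n =
     (if n = 0 then 1
      else - (\<Sum>k<n. of_nat (Suc n choose k) * bernoulli_num k) / of_nat (Suc n))"

declare bernoulli_num.simps [simp del]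

definition integral_at :: "nat \<Rightarrow> rat \<Rightarrow> bool" where
  "integral_at p x \<longleftrightarrow> coprime (snd (quotient_of x)) (int p)"

(* The library congruence is useless here: in the field rat every two numbers are congruent
   modulo any nonzero number. *)
definition rat_cong :: "nat \<Rightarrow> rat \<Rightarrow> rat \<Rightarrow> bool" where
  "rat_cong p x y \<longleftrightarrow>
     integral_at p x \<and> integral_at p y \<and> int p dvd fst (quotient_of (x - y))"

end

theory Submission
  imports Defs
begin

text \<open>
  Write \<open>S\<close> for the sum of \<open>(H\<^sub>j)\<^sup>2 / j\<^sup>r\<close> with \<open>H\<^sub>j = gen_harm s j\<close>, and \<open>D(a, b)\<close> for the
  double sum of \<open>gen_harm a j / j\<^sup>b\<close>, where \<open>j\<close> runs from \<open>1\<close> to \<open>p - 1\<close>. Squares of harmonic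
  numbers are removed modulo \<open>p\<close>, in one of two ways, so that only \<open>D\<close> has to be evaluated.

  If \<open>r\<close> is odd, use the symmetry \<open>j \<mapsto> p - j\<close>. Since the inverse \<open>s\<close>-th powers of all nonzero
  residues add up to \<open>0\<close> when \<open>p - 1\<close> does not divide \<open>s\<close>, one has \<open>H\<close> at \<open>p - j\<close> congruent to
  \<open>H\<close> at \<open>j - 1\<close> up to sign (\<open>gen_harm_reflect\<close>). The sign disappears in the square while
  \<open>1 / j\<^sup>r\<close> changes its sign, so \<open>S\<close> is congruent to \<open>- S + 2 D(s, r + s)\<close>
  (\<open>square_sum_cong_double_sum_odd\<close>). If \<open>r = s\<close>, of any parity, the cubes of the \<open>H\<^sub>j\<close> telescope,
  and expanding \<open>(H\<^sub>j - 1 / j\<^sup>s)\<^sup>3\<close> shows that \<open>3 S\<close> is congruent to \<open>3 D(s, 2 s)\<close>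
  (\<open>square_sum_cong_double_sum_diagonal\<close>); here \<open>p = 3\<close> is lost and is treated by a computation.

  The double sum is evaluated in \<open>harmonic_double_sum\<close>. By Fermat, negative exponents may be replaced
  by positive ones; then the inner sum is a polynomial in \<open>j\<close> by Faulhaber's formula, and summing
  the monomials over \<open>j\<close> kills all of them but one, whose coefficient contains the Bernoulli number
  with index \<open>p - a - b\<close>. For even \<open>s\<close>, reflection alone gives \<open>D(s, 2 s)\<close> congruent to its
  own negative (\<open>double_sum_cong_0\<close>), without any bound on \<open>s\<close>.
\<close>

section \<open>Bernoulli numbers and sums of powers\<close>

lemma bernoulli_num_recurrence:
  "(\<Sum>k<Suc n. of_nat (Suc n choose k) * bernoulli_num k) = (if n = 0 then 1 else 0)"
proof (cases "n = 0")
  case True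
  then show ?thesis by (simp add: bernoulli_num.simps)
next
  case False
  have "bernoulli_num n = - (\<Sum>k<n. of_nat (Suc n choose k) * bernoulli_num k) / of_nat (Suc n)"
    using False by (subst bernoulli_num.simps) simp
  then have "of_nat (Suc n) * bernoulli_num n = - (\<Sum>k<n. of_nat (Suc n choose k) * bernoulli_num k)"
    by (simp del: of_nat_Suc)
  then show ?thesis using False by (simp del: of_nat_Suc binomial_Suc_Suc)
qed

text \<open>Expanding the differences of powers by the binomial theorem and exchanging the two summations, the
  coefficient of \<open>x\<^sup>l\<close> contains the left-hand side of the Bernoulli recurrence for the index \<open>m - l\<close>;
  hence only \<open>l = m\<close> survives.\<close>

lemma faulhaber_step:
  fixes x :: rat
  shows "(\<Sum>i\<le>m. of_nat (Suc m choose i) * bernoulli_num i * ((x + 1) ^ (Suc m - i) - x ^ (Suc m - i)))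
       = of_nat (Suc m) * x ^ m"
proof -
  have binom: "(x + 1) ^ n - x ^ n = (\<Sum>l<n. of_nat (n choose l) * x ^ l)" for n
    by (subst binomial_ring) (simp add: lessThan_Suc_atMost[symmetric])
  have "(\<Sum>i\<le>m. of_nat (Suc m choose i) * bernoulli_num i * ((x + 1) ^ (Suc m - i) - x ^ (Suc m - i)))
      = (\<Sum>i\<le>m. \<Sum>l<Suc m - i. of_nat (Suc m choose i) * bernoulli_num i
           * (of_nat (Suc m - i choose l) * x ^ l))"
    by (simp only: binom sum_distrib_left)
  also have "\<dots> = (\<Sum>i<Suc m. \<Sum>l | l \<in> {..<Suc m} \<and> i + l < Suc m. of_nat (Suc m choose i) * bernoulli_num i
           * (of_nat (Suc m - i choose l) * x ^ l))"
    unfolding lessThan_Suc_atMost[symmetric]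
    by (intro sum.cong refl) auto
  also have "\<dots> = (\<Sum>l<Suc m. \<Sum>i | i \<in> {..<Suc m} \<and> i + l < Suc m. of_nat (Suc m choose i) * bernoulli_num i
           * (of_nat (Suc m - i choose l) * x ^ l))"
    by (rule sum.swap_restrict) auto
  also have "\<dots> = (\<Sum>l<Suc m. \<Sum>i<Suc (m - l). of_nat (Suc m choose l) * x ^ l
           * (of_nat (Suc (m - l) choose i) * bernoulli_num i))"
  proof (intro sum.cong refl, goal_cases)
    case (1 l) then show ?case by auto
  next
    case (2 l i)
    then have "l + i \<le> Suc m" by auto
    then have "(Suc m choose i) * (Suc m - i choose l) = (Suc m choose l) * (Suc m - l choose i)"
      using choose_mult[of i "l + i" "Suc m"] choose_mult[of l "l + i" "Suc m"]
        binomial_symmetric[of l "l + i"]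
      by (simp del: binomial_Suc_Suc)
    moreover have "Suc m - l = Suc (m - l)" using 2 by auto
    ultimately have "of_nat (Suc m choose i) * of_nat (Suc m - i choose l)
          = (of_nat (Suc m choose l) * of_nat (Suc (m - l) choose i) :: rat)"
      by (metis of_nat_mult)
    then show ?case by (simp only: mult.commute mult.left_commute mult.assoc)
  qed
  also have "\<dots> = (\<Sum>l<Suc m. of_nat (Suc m choose l) * x ^ l * (if m - l = 0 then 1 else 0))"
    by (simp only: sum_distrib_left[symmetric] bernoulli_num_recurrence)
  also have "\<dots> = of_nat (Suc m choose m) * x ^ m"
    by simp
  finally show ?thesis by simp
qed

text \<open>Both sides vanish for \<open>n = 0\<close> and have the same differences in \<open>n\<close>. The range of summation excludes
  \<open>n\<close> itself because of the convention that the Bernoulli number with index \<open>1\<close> is \<open>- 1 / 2\<close>.\<close>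

lemma faulhaber:
  "of_nat (Suc m) * (\<Sum>k<n. of_nat k ^ m)
     = (\<Sum>i\<le>m. of_nat (Suc m choose i) * bernoulli_num i * of_nat n ^ (Suc m - i))"
proof (induction n)
  case 0
  then show ?case by (simp add: zero_power)
next
  case (Suc n)
  have "of_nat (Suc m) * (\<Sum>k<Suc n. of_nat k ^ m)
      = (\<Sum>i\<le>m. of_nat (Suc m choose i) * bernoulli_num i * of_nat n ^ (Suc m - i))
        + of_nat (Suc m) * of_nat n ^ m"
    by (simp only: sum.lessThan_Suc distrib_left Suc.IH)
  also have "\<dots> = (\<Sum>i\<le>m. of_nat (Suc m choose i) * bernoulli_num i * of_nat (Suc n) ^ (Suc m - i))"
    unfolding faulhaber_step[symmetric] sum.distrib[symmetric] distrib_left[symmetric]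
    by (simp add: add.commute del: binomial_Suc_Suc)
  finally show ?case .
qed

lemma sum_power_drop_zero: "m > 0 \<Longrightarrow> (\<Sum>k<n. of_nat k ^ m) = (\<Sum>k=1..n-1. (of_nat k :: rat) ^ m)"
proof -
  assume "m > 0"
  have "(\<Sum>k<n. of_nat k ^ m) = (\<Sum>k\<in>{..<n} - {0}. (of_nat k :: rat) ^ m)"
    using \<open>m > 0\<close> by (intro sum.mono_neutral_right) auto
  also have "{..<n} - {0} = {1..n-1}" by auto
  finally show ?thesis .
qed

section \<open>Congruences between rationals integral at a prime\<close>

context
  fixes p :: nat
  assumes p: "prime p"
begin

abbreviation cong_mod_p :: "rat \<Rightarrow> rat \<Rightarrow> bool" (infix "\<equiv>\<^sub>p" 50) where
  "x \<equiv>\<^sub>p y \<equiv> rat_cong p x y"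

lemma prime_int_p: "prime (int p)"
  using p by simp

text \<open>The definition of integrality refers to the reduced fraction. Closure under the ring operations needs
  a criterion that accepts any fraction.\<close>

lemma integral_at_iff:
  "integral_at p x \<longleftrightarrow> (\<exists>a b. \<not> int p dvd b \<and> x = of_int a / of_int b)"
proof
  assume x: "integral_at p x"
  obtain a b where ab: "quotient_of x = (a, b)" by fastforce
  then have "coprime b (int p)" using x by (simp add: integral_at_def)
  then have "\<not> int p dvd b"
    using prime_int_p by (metis coprime_absorb_right not_prime_unit)
  then show "\<exists>a b. \<not> int p dvd b \<and> x = of_int a / of_int b"
    using quotient_of_div[OF ab] by blast
next
  assume "\<exists>a b. \<not> int p dvd b \<and> x = of_int a / of_int b"
  then obtain a b where b: "\<not> int p dvd b" and x: "x = of_int a / of_int b" by blast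
  obtain c d where cd: "quotient_of x = (c, d)" by fastforce
  have d: "d > 0" "coprime c d" "x = of_int c / of_int d"
    using quotient_of_denom_pos[OF cd] quotient_of_coprime[OF cd] quotient_of_div[OF cd] by auto
  have "b \<noteq> 0" using b by auto
  then have "(of_int (a * d) :: rat) = of_int (c * b)"
    using d x by (simp add: field_simps)
  then have "a * d = c * b" by (simp only: of_int_eq_iff)
  then have "d dvd c * b" by (metis dvd_triv_right)
  then have "d dvd b" using d(2) by (simp add: coprime_commute coprime_dvd_mult_right_iff)
  then have "\<not> int p dvd d" using b dvd_trans by blast
  then have "coprime d (int p)"
    using prime_int_p by (metis prime_imp_coprime coprime_commute)
  then show "integral_at p x" by (simp add: integral_at_def cd)
qed

lemma integral_at_of_int: "integral_at p (of_int a)"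
  unfolding integral_at_iff
  by (rule exI[of _ a], rule exI[of _ 1]) (use prime_int_p not_prime_unit in auto)

lemma integral_at_of_nat: "integral_at p (of_nat a)"
  using integral_at_of_int[of "int a"] by simp

lemma integral_at_0: "integral_at p 0" and integral_at_1: "integral_at p 1"
  using integral_at_of_nat[of 0] integral_at_of_nat[of 1] by simp_all

lemma integral_at_numeral: "integral_at p (numeral n)"
  using integral_at_of_nat[of "numeral n"] by simp

lemma integral_at_add:
  assumes "integral_at p x" "integral_at p y"
  shows "integral_at p (x + y)"
proof -
  obtain a b c d where *: "\<not> int p dvd b" "x = of_int a / of_int b"
      "\<not> int p dvd d" "y = of_int c / of_int d"
    using assms unfolding integral_at_iff by blast
  then have "\<not> int p dvd b * d" using prime_int_p by (simp add: prime_dvd_mult_iff)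
  moreover have "b \<noteq> 0" "d \<noteq> 0" using * by auto
  then have "x + y = of_int (a * d + c * b) / of_int (b * d)"
    using * by (simp add: add_frac_eq)
  ultimately show ?thesis unfolding integral_at_iff by blast
qed

lemma integral_at_mult:
  assumes "integral_at p x" "integral_at p y"
  shows "integral_at p (x * y)"
proof -
  obtain a b c d where *: "\<not> int p dvd b" "x = of_int a / of_int b"
      "\<not> int p dvd d" "y = of_int c / of_int d"
    using assms unfolding integral_at_iff by blast
  then have "\<not> int p dvd b * d" using prime_int_p by (simp add: prime_dvd_mult_iff)
  moreover have "x * y = of_int (a * c) / of_int (b * d)"
    using * by simp
  ultimately show ?thesis unfolding integral_at_iff by blast
qed

lemma integral_at_uminus: "integral_at p x \<Longrightarrow> integral_at p (- x)"
  using integral_at_mult[OF integral_at_of_int[of "-1"], of x] by simp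

lemma integral_at_diff: "integral_at p x \<Longrightarrow> integral_at p y \<Longrightarrow> integral_at p (x - y)"
  using integral_at_add[OF _ integral_at_uminus, of x y] by simp

lemma integral_at_power: "integral_at p x \<Longrightarrow> integral_at p (x ^ n)"
  by (induction n) (simp_all add: integral_at_1 integral_at_mult)

lemma integral_at_sum: "(\<And>i. i \<in> A \<Longrightarrow> integral_at p (f i)) \<Longrightarrow> integral_at p (sum f A)"
  by (induction A rule: infinite_finite_induct) (simp_all add: integral_at_0 integral_at_add)

lemma integral_at_inverse_of_nat:
  assumes "\<not> p dvd n"
  shows "integral_at p (1 / of_nat n)"
  unfolding integral_at_iff
  by (rule exI[of _ 1], rule exI[of _ "int n"]) (use assms in auto)

lemma integral_at_divide_of_nat:
  "integral_at p x \<Longrightarrow> \<not> p dvd n \<Longrightarrow> integral_at p (x / of_nat n)"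
  using integral_at_mult[OF _ integral_at_inverse_of_nat, of x n] by simp

lemmas integral_at_intros = integral_at_0 integral_at_1 integral_at_numeral integral_at_of_nat
  integral_at_add integral_at_uminus integral_at_diff integral_at_mult integral_at_power
  integral_at_sum integral_at_divide_of_nat

text \<open>Congruence as divisibility in the local ring of \<open>p\<close>-integral rationals: in this form it is
  visibly compatible with the ring operations.\<close>

lemma rat_cong_iff:
  "x \<equiv>\<^sub>p y \<longleftrightarrow> integral_at p x \<and> integral_at p y \<and> (\<exists>z. integral_at p z \<and> x - y = of_nat p * z)"
proof -
  have "int p dvd fst (quotient_of w) \<longleftrightarrow> (\<exists>z. integral_at p z \<and> w = of_nat p * z)"
    if w: "integral_at p w" for w
  proof -
    obtain a b where ab: "quotient_of w = (a, b)" by fastforce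
    have b: "b > 0" "w = of_int a / of_int b"
      using quotient_of_denom_pos[OF ab] quotient_of_div[OF ab] by auto
    have "coprime b (int p)" using w ab by (simp add: integral_at_def)
    then have nb: "\<not> int p dvd b"
      using prime_int_p by (metis coprime_absorb_right not_prime_unit)
    show ?thesis
    proof
      assume "int p dvd fst (quotient_of w)"
      then obtain k where "a = int p * k" using ab by auto
      then have "w = of_nat p * (of_int k / of_int b)" using b by simp
      then show "\<exists>z. integral_at p z \<and> w = of_nat p * z" using nb unfolding integral_at_iff by blast
    next
      assume "\<exists>z. integral_at p z \<and> w = of_nat p * z"
      then obtain c d where cd: "\<not> int p dvd d" "w = of_nat p * (of_int c / of_int d)"
        unfolding integral_at_iff by blast
      then have "d \<noteq> 0" by auto
      then have "(of_int (a * d) :: rat) = of_int (int p * c * b)"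
        using b cd by (simp add: field_simps)
      then have "a * d = int p * c * b" by (simp only: of_int_eq_iff)
      then have "int p dvd a * d" by simp
      then show "int p dvd fst (quotient_of w)"
        using cd(1) prime_int_p ab by (simp add: prime_dvd_mult_iff)
    qed
  qed
  then show ?thesis unfolding rat_cong_def using integral_at_diff by blast
qed

lemma rat_cong_integral:
  assumes "x \<equiv>\<^sub>p y" shows "integral_at p x" "integral_at p y"
  using assms by (simp_all add: rat_cong_def)

lemma rat_congI: "integral_at p y \<Longrightarrow> integral_at p z \<Longrightarrow> x = y + of_nat p * z \<Longrightarrow> x \<equiv>\<^sub>p y"
  unfolding rat_cong_iff by (auto intro!: integral_at_intros)

lemma rat_cong_refl: "integral_at p x \<Longrightarrow> x \<equiv>\<^sub>p x"
  by (rule rat_congI[of _ 0]) (auto intro: integral_at_intros)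

lemma rat_congE:
  assumes "x \<equiv>\<^sub>p y"
  obtains z where "integral_at p z" "x = y + of_nat p * z"
  using assms unfolding rat_cong_iff by (metis add.commute diff_add_cancel)

lemma rat_cong_add:
  assumes "x \<equiv>\<^sub>p y" "u \<equiv>\<^sub>p v" shows "x + u \<equiv>\<^sub>p y + v"
proof -
  obtain z w where "integral_at p z" "x = y + of_nat p * z" "integral_at p w" "u = v + of_nat p * w"
    using assms rat_congE by metis
  then show ?thesis
    using assms[THEN rat_cong_integral(2)]
    by (intro rat_congI[of _ "z + w"] integral_at_intros) (auto simp: algebra_simps)
qed

lemma rat_cong_mult:
  assumes "x \<equiv>\<^sub>p y" "u \<equiv>\<^sub>p v" shows "x * u \<equiv>\<^sub>p y * v"
proof -
  obtain z w where zw: "integral_at p z" "x = y + of_nat p * z" "integral_at p w" "u = v + of_nat p * w"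
    using assms rat_congE by metis
  have "integral_at p (z * v + y * w + of_nat p * z * w)"
    using zw assms[THEN rat_cong_integral(2)] by (intro integral_at_intros)
  then show ?thesis
    using zw assms[THEN rat_cong_integral(2)]
    by (intro rat_congI[of _ "z * v + y * w + of_nat p * z * w"] integral_at_mult)
       (auto simp: algebra_simps)
qed

lemma rat_cong_cmult: "integral_at p c \<Longrightarrow> x \<equiv>\<^sub>p y \<Longrightarrow> c * x \<equiv>\<^sub>p c * y"
  by (rule rat_cong_mult[OF rat_cong_refl])

lemma rat_cong_uminus: "x \<equiv>\<^sub>p y \<Longrightarrow> - x \<equiv>\<^sub>p - y"
  using rat_cong_cmult[OF integral_at_uminus[OF integral_at_1], of x y] by simp

lemma rat_cong_diff: "x \<equiv>\<^sub>p y \<Longrightarrow> u \<equiv>\<^sub>p v \<Longrightarrow> x - u \<equiv>\<^sub>p y - v"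
  using rat_cong_add[OF _ rat_cong_uminus, of x y u v] by simp

lemma rat_cong_trans [trans]: "x \<equiv>\<^sub>p y \<Longrightarrow> y \<equiv>\<^sub>p z \<Longrightarrow> x \<equiv>\<^sub>p z"
proof -
  assume xy: "x \<equiv>\<^sub>p y" and yz: "y \<equiv>\<^sub>p z"
  obtain u v where "integral_at p u" "x = y + of_nat p * u" "integral_at p v" "y = z + of_nat p * v"
    using xy yz rat_congE by metis
  then show "x \<equiv>\<^sub>p z"
    using rat_cong_integral(2)[OF yz]
    by (intro rat_congI[of _ "u + v"] integral_at_add) (auto simp: algebra_simps)
qed

lemma rat_cong_sym: "x \<equiv>\<^sub>p y \<Longrightarrow> y \<equiv>\<^sub>p x"
proof -
  assume xy: "x \<equiv>\<^sub>p y"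
  obtain z where "integral_at p z" "x = y + of_nat p * z" using xy rat_congE by metis
  then show "y \<equiv>\<^sub>p x"
    using rat_cong_integral(1)[OF xy] by (intro rat_congI[of _ "- z"] integral_at_uminus) auto
qed

lemma rat_cong_power: "x \<equiv>\<^sub>p y \<Longrightarrow> x ^ n \<equiv>\<^sub>p y ^ n"
  by (induction n) (simp_all add: rat_cong_refl integral_at_1 rat_cong_mult)

lemma rat_cong_sum: "(\<And>i. i \<in> A \<Longrightarrow> f i \<equiv>\<^sub>p g i) \<Longrightarrow> sum f A \<equiv>\<^sub>p sum g A"
  by (induction A rule: infinite_finite_induct) (simp_all add: rat_cong_refl integral_at_0 rat_cong_add)

lemma rat_cong_prod: "(\<And>i. i \<in> A \<Longrightarrow> f i \<equiv>\<^sub>p g i) \<Longrightarrow> prod f A \<equiv>\<^sub>p prod g A"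
  by (induction A rule: infinite_finite_induct) (simp_all add: rat_cong_refl integral_at_1 rat_cong_mult)

lemma rat_cong_cancel_of_nat:
  assumes "of_nat n * x \<equiv>\<^sub>p of_nat n * y" "\<not> p dvd n"
  shows "x \<equiv>\<^sub>p y"
proof -
  have "n \<noteq> 0" using assms(2) by (metis dvd_0_right)
  then show ?thesis
    using rat_cong_cmult[OF integral_at_inverse_of_nat[OF assms(2)] assms(1)] by simp
qed

lemma rat_cong_of_nat:
  assumes "[m = n] (mod p)"
  shows "of_nat m \<equiv>\<^sub>p of_nat n"
proof -
  have "[int m = int n] (mod int p)" using assms by (simp add: cong_int_iff)
  then obtain k where "int m - int n = int p * k" by (metis cong_iff_dvd_diff dvdE)
  then have "(of_int (int m) :: rat) = of_int (int n + int p * k)"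
    by (metis add.commute diff_add_cancel)
  then show ?thesis
    by (intro rat_congI[of _ "of_int k"] integral_at_of_nat integral_at_of_int) simp
qed

section \<open>Power sums modulo a prime\<close>

lemma not_dvd_range: "j \<in> {1..p-1} \<Longrightarrow> \<not> p dvd j"
  using p by (auto dest!: dvd_imp_le simp: prime_gt_0_nat)

lemma not_dvd_range_power: "j \<in> {1..p-1} \<Longrightarrow> \<not> p dvd j ^ s"
  using not_dvd_range p prime_dvd_power by blast

lemma power_cong_1:
  assumes "j \<in> {1..p-1}" "(p - 1) dvd e"
  shows "of_nat j ^ e \<equiv>\<^sub>p 1"
proof -
  obtain k where k: "e = (p - 1) * k" using assms(2) by blast
  have "[j ^ (p - 1) = 1] (mod p)"
    using fermat_theorem[OF p not_dvd_range[OF assms(1)]] .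
  then have "[(j ^ (p - 1)) ^ k = 1 ^ k] (mod p)" by (rule cong_pow)
  then show ?thesis using rat_cong_of_nat[of "j ^ e" 1] by (simp add: k power_mult)
qed

lemma integral_at_inverse_power: "j \<in> {1..p-1} \<Longrightarrow> integral_at p (1 / of_nat j ^ s)"
  using integral_at_inverse_of_nat[OF not_dvd_range_power, of j s] by simp

lemma inverse_power_cong_power:
  assumes "j \<in> {1..p-1}" "(p - 1) dvd s + t"
  shows "1 / of_nat j ^ s \<equiv>\<^sub>p of_nat j ^ t"
proof -
  have "1 / of_nat j ^ s * (of_nat j ^ (s + t)) \<equiv>\<^sub>p 1 / of_nat j ^ s * 1"
    using assms by (intro rat_cong_cmult integral_at_inverse_power power_cong_1)
  moreover have "of_nat j \<noteq> (0 :: rat)" using assms(1) by auto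
  ultimately show ?thesis by (simp add: power_add rat_cong_sym)
qed

text \<open>Solving the recurrence for the Bernoulli number with index \<open>n\<close> divides only by numbers up to
  \<open>n + 1\<close>, so \<open>p\<close> cannot enter the denominator before index \<open>p - 1\<close>.\<close>

lemma integral_at_bernoulli_num: "Suc n < p \<Longrightarrow> integral_at p (bernoulli_num n)"
proof (induction n rule: less_induct)
  case (less n)
  show ?case
  proof (cases "n = 0")
    case True
    then show ?thesis by (simp add: bernoulli_num.simps integral_at_1)
  next
    case False
    have "\<not> p dvd Suc n" using less.prems not_dvd_range[of "Suc n"] by auto
    moreover have "integral_at p (- (\<Sum>k<n. of_nat (Suc n choose k) * bernoulli_num k))"
      using less by (intro integral_at_intros) auto
    ultimately have "integral_at p (- (\<Sum>k<n. of_nat (Suc n choose k) * bernoulli_num k) / of_nat (Suc n))"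
      by (rule integral_at_divide_of_nat[rotated])
    then show ?thesis using False by (subst bernoulli_num.simps) simp
  qed
qed

text \<open>By Fermat, the exponent matters only modulo \<open>p - 1\<close>. If its residue \<open>m\<close> is nonzero, then
  \<open>m + 1 < p\<close>, and Faulhaber's formula exhibits \<open>m + 1\<close> times the sum as a polynomial in \<open>p\<close> with
  \<open>p\<close>-integral coefficients and no constant term.\<close>

lemma power_sum_cong:
  "(\<Sum>j=1..p-1. of_nat j ^ e) \<equiv>\<^sub>p (if (p - 1) dvd e then - 1 else 0)"
proof (cases "(p - 1) dvd e")
  case True
  have "(\<Sum>j=1..p-1. of_nat j ^ e) \<equiv>\<^sub>p (\<Sum>j=1..p-1. 1)"
    using True by (intro rat_cong_sum power_cong_1)
  also have "(\<Sum>j=1..p-1. 1 :: rat) \<equiv>\<^sub>p - 1"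
    using prime_gt_0_nat[OF p]
    by (intro rat_congI[of _ 1] integral_at_intros) (simp add: of_nat_diff)
  finally show ?thesis using True by simp
next
  case False
  define m where "m = e mod (p - 1)"
  have m0: "m > 0" using False by (auto simp: m_def dvd_eq_mod_eq_0)
  have mp: "Suc m < p"
    using mod_less_divisor[of "p - 1" e] prime_gt_1_nat[OF p] unfolding m_def by linarith
  have "(\<Sum>j=1..p-1. of_nat j ^ e) \<equiv>\<^sub>p (\<Sum>j=1..p-1. of_nat j ^ m)"
  proof (rule rat_cong_sum)
    fix j assume j: "j \<in> {1..p-1}"
    have "of_nat j ^ ((p - 1) * (e div (p - 1))) * of_nat j ^ m \<equiv>\<^sub>p 1 * of_nat j ^ m"
      by (intro rat_cong_mult power_cong_1 j rat_cong_refl integral_at_intros) simp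
    then show "of_nat j ^ e \<equiv>\<^sub>p of_nat j ^ m"
      by (simp add: m_def power_add[symmetric])
  qed
  also have "(\<Sum>j=1..p-1. of_nat j ^ m) \<equiv>\<^sub>p 0"
  proof (rule rat_cong_cancel_of_nat[of "Suc m"])
    have "of_nat (Suc m) * (\<Sum>j=1..p-1. of_nat j ^ m)
        = (\<Sum>i\<le>m. of_nat (Suc m choose i) * bernoulli_num i * of_nat p ^ (Suc m - i))"
      using faulhaber[of m p] m0 by (simp only: sum_power_drop_zero)
    also have "\<dots> = 0 + of_nat p * (\<Sum>i\<le>m. of_nat (Suc m choose i) * bernoulli_num i * of_nat p ^ (m - i))"
      by (auto simp: sum_distrib_left Suc_diff_le intro!: sum.cong)
    finally show "of_nat (Suc m) * (\<Sum>j=1..p-1. of_nat j ^ m) \<equiv>\<^sub>p of_nat (Suc m) * 0"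
      using mp by (intro rat_congI) (auto intro!: integral_at_intros integral_at_bernoulli_num)
    show "\<not> p dvd Suc m" using mp not_dvd_range[of "Suc m"] by auto
  qed
  finally show ?thesis using False by simp
qed

text \<open>The inverse \<open>s\<close>-th power is the power with exponent \<open>(p - 2) s\<close>, for every \<open>s\<close>, and
  \<open>p - 1\<close> divides this exponent only if it divides \<open>s\<close>.\<close>

lemma inverse_power_sum_cong:
  assumes "\<not> (p - 1) dvd s"
  shows "(\<Sum>j=1..p-1. 1 / of_nat j ^ s) \<equiv>\<^sub>p 0"
proof -
  have e: "s + (p - 2) * s = (p - 1) * s"
    using prime_ge_2_nat[OF p] by (metis Suc_1 Suc_diff_le add.commute diff_Suc_Suc mult_Suc)
  have "\<not> (p - 1) dvd (p - 2) * s"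
    using assms e by (metis dvd_add_left_iff dvd_triv_left)
  then have 0: "(\<Sum>j=1..p-1. of_nat j ^ ((p - 2) * s)) \<equiv>\<^sub>p 0"
    using power_sum_cong[of "(p - 2) * s"] by simp
  have "(\<Sum>j=1..p-1. 1 / of_nat j ^ s) \<equiv>\<^sub>p (\<Sum>j=1..p-1. of_nat j ^ ((p - 2) * s))"
    by (intro rat_cong_sum inverse_power_cong_power) (simp_all add: e)
  also note 0
  finally show ?thesis .
qed

section \<open>Harmonic numbers and reflection\<close>

lemma gen_harm_Suc: "gen_harm s (Suc n) = gen_harm s n + 1 / of_nat (Suc n) ^ s"
  by (simp add: gen_harm_def)

lemma gen_harm_pred: "j > 0 \<Longrightarrow> gen_harm s (j - 1) = gen_harm s j - 1 / of_nat j ^ s"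
  using gen_harm_Suc[of s "j - 1"] by simp

lemma integral_at_gen_harm: "n \<le> p - 1 \<Longrightarrow> integral_at p (gen_harm s n)"
  unfolding gen_harm_def by (intro integral_at_sum integral_at_inverse_power) auto

lemma inverse_power_reflect:
  assumes "j \<in> {1..p-1}"
  shows "1 / of_nat (p - j) ^ s \<equiv>\<^sub>p (- 1) ^ s * (1 / of_nat j ^ s)"
proof -
  have j: "of_nat j \<noteq> (0 :: rat)" "of_nat (p - j) \<noteq> (0 :: rat)" "j \<le> p" using assms by auto
  have pj: "p - j \<in> {1..p-1}" using assms by auto
  have int: "integral_at p (1 / of_nat j)" "integral_at p (1 / of_nat (p - j))"
    using integral_at_inverse_power[OF assms, of 1] integral_at_inverse_power[OF pj, of 1] by simp_all
  have "1 / of_nat (p - j) = - (1 / of_nat j) + of_nat p * (1 / of_nat (p - j) * (1 / of_nat j) :: rat)"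
    using j by (simp add: field_simps of_nat_diff)
  then have "1 / of_nat (p - j) \<equiv>\<^sub>p - (1 / of_nat j)"
    by (rule rat_congI[OF integral_at_uminus[OF int(1)] integral_at_mult[OF int(2,1)]])
  from rat_cong_power[OF this, of s] show ?thesis
    by (simp add: power_divide power_minus[of "1 / of_nat j"])
qed

text \<open>The complete sum vanishes by \<open>inverse_power_sum_cong\<close>, so the first \<open>p - 1 - i\<close> terms are the
  negative of the last \<open>i\<close> terms, and these are the first \<open>i\<close> terms up to the sign of \<open>(- 1)\<^sup>s\<close>.\<close>

lemma gen_harm_reflect:
  assumes "\<not> (p - 1) dvd s" "i < p"
  shows "gen_harm s (p - 1 - i) \<equiv>\<^sub>p - ((- 1) ^ s * gen_harm s i)"
  using assms(2)
proof (induction i)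
  case 0
  then show ?case using inverse_power_sum_cong[OF assms(1)] by (simp add: gen_harm_def)
next
  case (Suc i)
  have "gen_harm s (p - 1 - Suc i) = gen_harm s (p - 1 - i) - 1 / of_nat (p - Suc i) ^ s"
    using gen_harm_pred[of "p - 1 - i" s] Suc.prems by simp
  also have "\<dots> \<equiv>\<^sub>p - ((- 1) ^ s * gen_harm s i) - (- 1) ^ s * (1 / of_nat (Suc i) ^ s)"
    using Suc by (intro rat_cong_diff inverse_power_reflect) auto
  also have "\<dots> = - ((- 1) ^ s * gen_harm s (Suc i))"
    by (simp add: gen_harm_Suc algebra_simps)
  finally show ?case .
qed

lemma gen_harm_reflect_pred:
  assumes "\<not> (p - 1) dvd s" "j \<in> {1..p-1}"
  shows "gen_harm s (p - j) \<equiv>\<^sub>p - ((- 1) ^ s * (gen_harm s j - 1 / of_nat j ^ s))"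
  using gen_harm_reflect[OF assms(1), of "j - 1"] gen_harm_pred[of j s] assms(2) by auto

lemma sum_reflect: "(\<Sum>j=1..p-1. f j) = (\<Sum>j=1..p-1. f (p - j))"
  using sum.atLeastAtMost_rev[of f 1 "p - 1"] prime_gt_0_nat[OF p] by simp

section \<open>The double sum\<close>

text \<open>Modulo \<open>p\<close> the upper entry \<open>p - a\<close> becomes \<open>- a\<close>, and a binomial coefficient with negative upper
  entry is an ordinary one up to sign. Multiplying by the factorial of \<open>b\<close>, a unit, makes both sides
  products of \<open>b\<close> factors that can be compared one by one.\<close>

lemma binomial_reflect:
  assumes "0 < a" "a \<le> p" "b < p"
  shows "of_nat ((p - a) choose b) \<equiv>\<^sub>p (- 1) ^ b * of_nat ((a + b - 1) choose b)"
proof (rule rat_cong_cancel_of_nat[of "fact b"])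
  show "\<not> p dvd fact b" using p assms(3) by (simp add: prime_dvd_fact_iff)
  have "of_nat (fact b) * of_nat ((p - a) choose b) = (\<Prod>i=0..<b. of_nat p - of_nat a - of_nat i :: rat)"
    using assms(2) gbinomial_mult_fact[of b "of_nat (p - a) :: rat"]
    by (simp add: binomial_gbinomial of_nat_diff)
  also have "\<dots> \<equiv>\<^sub>p (\<Prod>i=0..<b. - of_nat a - of_nat i)"
    by (intro rat_cong_prod rat_congI[of _ 1] integral_at_intros) simp
  also have "\<dots> = fact b * (- of_nat a gchoose b)"
    by (simp add: gbinomial_mult_fact)
  also have "\<dots> = of_nat (fact b) * ((- 1) ^ b * of_nat ((a + b - 1) choose b))"
    using assms(1) by (simp add: gbinomial_minus binomial_gbinomial of_nat_diff)
  finally show "of_nat (fact b) * of_nat ((p - a) choose b)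
      \<equiv>\<^sub>p of_nat (fact b) * ((- 1) ^ b * of_nat ((a + b - 1) choose b))" .
qed

text \<open>Replace \<open>k\<close> to the power \<open>- a\<close> by \<open>k\<^sup>m\<close> with \<open>m = p - 1 - a\<close>, and \<open>j\<close> to the power \<open>- b\<close> by \<open>j\<close> to
  the power \<open>p - 1 - b\<close>. Faulhaber's formula for the inner sum and \<open>power_sum_cong\<close> for the outer one
  leave those indices \<open>i\<close> for which \<open>p - 1\<close> divides \<open>a + b + i - 1\<close>. This number lies
  strictly between \<open>0\<close> and \<open>2 (p - 1)\<close>, so \<open>i = p - a - b\<close> is the only one. The rest of the proof
  rewrites the remaining binomial coefficient, which depends on \<open>p\<close>, by \<open>binomial_reflect\<close>.\<close>

lemma harmonic_double_sum:
  assumes a: "1 \<le> a" and b: "1 \<le> b" and ab: "a + b < p - 1"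
  shows "(\<Sum>j=1..p-1. gen_harm a j / of_nat j ^ b)
    \<equiv>\<^sub>p (- 1) ^ b * of_nat ((a + b) choose a) * (bernoulli_num (p - a - b) / of_nat (a + b))"
    (is "?D \<equiv>\<^sub>p ?R")
proof -
  define m where "m = p - 1 - a"
  define i0 where "i0 = p - a - b"
  define B where "B = bernoulli_num i0"
  have m: "Suc m = p - a" "m > 0" "m < p - 1" using a ab by (auto simp: m_def)
  have i0: "i0 \<le> m" "Suc i0 < p" using a b ab by (auto simp: m_def i0_def)
  have B: "integral_at p B" unfolding B_def using i0(2) by (rule integral_at_bernoulli_num)
  have "\<not> p dvd a + b" using not_dvd_range[of "a + b"] a ab by auto
  then have R: "integral_at p ?R" unfolding i0_def[symmetric] B_def[symmetric]
    by (intro integral_at_intros B)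
  \<comment> \<open>Faulhaber's formula sums over \<open>k < j\<close>, so the diagonal terms \<open>k = j\<close> are split off; their sum vanishes modulo \<open>p\<close>.\<close>
  have "?D = (\<Sum>j=1..p-1. gen_harm a (j - 1) / of_nat j ^ b) + (\<Sum>j=1..p-1. 1 / of_nat j ^ (a + b))"
    unfolding sum.distrib[symmetric]
  proof (rule sum.cong[OF refl])
    fix j assume "j \<in> {1..p-1}"
    then have j: "j > 0" by auto
    show "gen_harm a j / of_nat j ^ b = gen_harm a (j - 1) / of_nat j ^ b + 1 / of_nat j ^ (a + b)"
      unfolding gen_harm_pred[OF j] by (simp add: diff_divide_distrib power_add)
  qed
  also have "\<dots> \<equiv>\<^sub>p (\<Sum>j=1..p-1. (\<Sum>k<j. of_nat k ^ m) * of_nat j ^ (p - 1 - b)) + 0"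
  proof (rule rat_cong_add)
    show "(\<Sum>j=1..p-1. gen_harm a (j - 1) / of_nat j ^ b)
       \<equiv>\<^sub>p (\<Sum>j=1..p-1. (\<Sum>k<j. of_nat k ^ m) * of_nat j ^ (p - 1 - b))"
    proof (rule rat_cong_sum)
      fix j assume j: "j \<in> {1..p-1}"
      have "gen_harm a (j - 1) * (1 / of_nat j ^ b) \<equiv>\<^sub>p (\<Sum>k<j. of_nat k ^ m) * of_nat j ^ (p - 1 - b)"
        unfolding gen_harm_def sum_power_drop_zero[OF m(2)]
        using j ab by (intro rat_cong_mult rat_cong_sum inverse_power_cong_power) (auto simp: m_def)
      then show "gen_harm a (j - 1) / of_nat j ^ b \<equiv>\<^sub>p (\<Sum>k<j. of_nat k ^ m) * of_nat j ^ (p - 1 - b)"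
        by simp
    qed
    have "\<not> (p - 1) dvd a + b" using a ab by (auto dest: dvd_imp_le)
    then show "(\<Sum>j=1..p-1. 1 / of_nat j ^ (a + b)) \<equiv>\<^sub>p 0" by (rule inverse_power_sum_cong)
  qed
  finally have D: "?D \<equiv>\<^sub>p (\<Sum>j=1..p-1. (\<Sum>k<j. of_nat k ^ m) * of_nat j ^ (p - 1 - b))"
    by simp
  have "of_nat (Suc m) * ?D \<equiv>\<^sub>p of_nat (Suc m) * (\<Sum>j=1..p-1. (\<Sum>k<j. of_nat k ^ m) * of_nat j ^ (p - 1 - b))"
    by (intro rat_cong_cmult D integral_at_of_nat)
  also have "\<dots> = (\<Sum>j=1..p-1. (of_nat (Suc m) * (\<Sum>k<j. of_nat k ^ m)) * of_nat j ^ (p - 1 - b))"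
    by (subst sum_distrib_left) (simp only: mult.assoc)
  also have "\<dots> = (\<Sum>j=1..p-1. \<Sum>i\<le>m. of_nat (Suc m choose i) * bernoulli_num i
                      * of_nat j ^ (Suc m - i + (p - 1 - b)))"
    by (simp only: faulhaber sum_distrib_right power_add mult.assoc)
  also have "\<dots> = (\<Sum>i\<le>m. of_nat (Suc m choose i) * bernoulli_num i
                      * (\<Sum>j=1..p-1. of_nat j ^ (Suc m - i + (p - 1 - b))))"
    by (subst sum.swap) (simp only: sum_distrib_left)
  also have "\<dots> \<equiv>\<^sub>p (\<Sum>i\<le>m. of_nat (Suc m choose i) * bernoulli_num i * (if i = i0 then - 1 else 0))"
  proof (rule rat_cong_sum)
    fix i assume i: "i \<in> {..m}"
    have e: "Suc m - i + (p - 1 - b) + (a + b + i - 1) = 2 * (p - 1)"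
      using i m a b ab by auto
    have "(p - 1) dvd Suc m - i + (p - 1 - b) \<longleftrightarrow> (p - 1) dvd a + b + i - 1"
      using e by (metis dvd_add_right_iff dvd_add_left_iff dvd_triv_right)
    also have "\<dots> \<longleftrightarrow> i = i0"
    proof
      assume "(p - 1) dvd a + b + i - 1"
      then obtain k where k: "a + b + i - 1 = (p - 1) * k" by blast
      have "0 < a + b + i - 1" "a + b + i - 1 < (p - 1) * 2" using i m a b ab by auto
      then have "0 < k" "k < 2" unfolding k by simp_all
      then have "k = 1" by simp
      then show "i = i0" using k ab a by (auto simp: i0_def)
    next
      assume "i = i0"
      then show "(p - 1) dvd a + b + i - 1" using a ab by (auto simp: i0_def)
    qed
    finally have "(p - 1) dvd Suc m - i + (p - 1 - b) \<longleftrightarrow> i = i0" .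
    then show "of_nat (Suc m choose i) * bernoulli_num i * (\<Sum>j=1..p-1. of_nat j ^ (Suc m - i + (p - 1 - b)))
        \<equiv>\<^sub>p of_nat (Suc m choose i) * bernoulli_num i * (if i = i0 then - 1 else 0)"
      using power_sum_cong[of "Suc m - i + (p - 1 - b)"] i m
      by (intro rat_cong_cmult integral_at_intros integral_at_bernoulli_num) auto
  qed
  also have "\<dots> = of_nat (Suc m choose i0) * (- B)"
    using i0 by (simp add: B_def if_distrib cong: if_cong del: binomial_Suc_Suc)
  also have "Suc m choose i0 = (p - a) choose b"
    using binomial_symmetric[of b "p - a"] ab by (simp add: m i0_def)
  also have "of_nat ((p - a) choose b) * (- B) \<equiv>\<^sub>p ((- 1) ^ b * of_nat ((a + b - 1) choose b)) * (- B)"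
    using a ab by (intro rat_cong_mult binomial_reflect rat_cong_refl integral_at_intros B) auto
  also have "\<dots> = - (of_nat a * ?R)"
  proof -
    have "a * ((a + b) choose a) = (a + b) * ((a + b - 1) choose (a - 1))"
      using a by (metis binomial_absorption less_eq_Suc_le One_nat_def Suc_diff_1 times_binomial_minus1_eq)
    also have "(a + b - 1) choose (a - 1) = (a + b - 1) choose b"
      using binomial_symmetric[of b "a + b - 1"] a by simp
    finally have "of_nat a * of_nat ((a + b) choose a) = (of_nat (a + b) * of_nat ((a + b - 1) choose b) :: rat)"
      by (metis of_nat_mult)
    then have "of_nat ((a + b - 1) choose b) = (of_nat a * of_nat ((a + b) choose a) / of_nat (a + b) :: rat)"
      using a by (simp add: field_simps)
    then show ?thesis by (simp add: B_def i0_def)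
  qed
  also have "\<dots> \<equiv>\<^sub>p of_nat (Suc m) * ?R"
  proof (rule rat_cong_sym, rule rat_congI[OF _ R])
    show "integral_at p (- (of_nat a * ?R))" by (intro integral_at_uminus integral_at_mult R integral_at_of_nat)
    have Suc_m: "(of_nat (Suc m) :: rat) = of_nat p - of_nat a"
      unfolding m using ab by (intro of_nat_diff) simp
    show "of_nat (Suc m) * ?R = - (of_nat a * ?R) + of_nat p * ?R"
      unfolding Suc_m by (simp only: left_diff_distrib uminus_add_conv_diff)
  qed
  finally have "of_nat (Suc m) * ?D \<equiv>\<^sub>p of_nat (Suc m) * ?R" .
  moreover have "\<not> p dvd Suc m" using m not_dvd_range[of "Suc m"] by auto
  ultimately show ?thesis by (rule rat_cong_cancel_of_nat)
qed

section \<open>Sums with squared harmonic numbers\<close>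

lemma integral_at_harmonic_double_sum: "integral_at p (\<Sum>j=1..p-1. gen_harm a j / of_nat j ^ b)"
proof -
  have "integral_at p (gen_harm a j * (1 / of_nat j ^ b))" if "j \<in> {1..p-1}" for j
    using that by (intro integral_at_mult integral_at_gen_harm integral_at_inverse_power) auto
  then show ?thesis by (intro integral_at_sum) simp
qed

lemma integral_at_harmonic_square_sum: "integral_at p (\<Sum>j=1..p-1. (gen_harm s j)\<^sup>2 / of_nat j ^ r)"
proof -
  have "integral_at p ((gen_harm s j)\<^sup>2 * (1 / of_nat j ^ r))" if "j \<in> {1..p-1}" for j
    using that by (intro integral_at_mult integral_at_power integral_at_gen_harm integral_at_inverse_power) auto
  then show ?thesis by (intro integral_at_sum) simp
qed

lemma rat_cong_move: "x \<equiv>\<^sub>p - x + y \<Longrightarrow> 2 * x \<equiv>\<^sub>p y"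
  using rat_cong_add[of x "- x + y" x x] rat_cong_refl rat_cong_integral(1) by fastforce

lemma rat_cong_halve: "p \<noteq> 2 \<Longrightarrow> 2 * x \<equiv>\<^sub>p 2 * y \<Longrightarrow> x \<equiv>\<^sub>p y"
  using rat_cong_cancel_of_nat[of 2 x y] primes_dvd_imp_eq[OF p two_is_prime_nat] by auto

text \<open>Reflection turns \<open>S\<close> into minus the sum of \<open>(H\<^sub>j - 1 / j\<^sup>s)\<^sup>2 / j\<^sup>r\<close>. Expanding the square gives
  \<open>- S + 2 D\<close> and a complete sum of inverse powers with exponent \<open>2 s + r\<close>, which vanishes.\<close>

lemma square_sum_cong_double_sum_odd:
  assumes "p \<noteq> 2" "odd r" "\<not> (p - 1) dvd s" "\<not> (p - 1) dvd 2 * s + r"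
  shows "(\<Sum>j=1..p-1. (gen_harm s j)\<^sup>2 / of_nat j ^ r) \<equiv>\<^sub>p (\<Sum>j=1..p-1. gen_harm s j / of_nat j ^ (r + s))"
    (is "?S \<equiv>\<^sub>p ?D")
proof -
  let ?T = "\<Sum>j=1..p-1. 1 / of_nat j ^ (2 * s + r) :: rat"
  have "?S = (\<Sum>j=1..p-1. (gen_harm s (p - j))\<^sup>2 * (1 / of_nat (p - j) ^ r))"
    by (subst sum_reflect) simp
  also have "\<dots> \<equiv>\<^sub>p (\<Sum>j=1..p-1. (- ((- 1) ^ s * (gen_harm s j - 1 / of_nat j ^ s)))\<^sup>2
                          * ((- 1) ^ r * (1 / of_nat j ^ r)))"
    using assms by (intro rat_cong_sum rat_cong_mult rat_cong_power gen_harm_reflect_pred inverse_power_reflect)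
  also have "\<dots> = (\<Sum>j=1..p-1. - ((gen_harm s j)\<^sup>2 / of_nat j ^ r)
                      + (2 * (gen_harm s j / of_nat j ^ (r + s)) - 1 / of_nat j ^ (2 * s + r)))"
  proof (rule sum.cong[OF refl])
    fix j
    define x y where "x = (1 / of_nat j ^ s :: rat)" and "y = (1 / of_nat j ^ r :: rat)"
    have xy: "1 / of_nat j ^ (r + s) = x * y" "1 / of_nat j ^ (2 * s + r) = x\<^sup>2 * y"
      by (simp_all add: x_def y_def power_add mult_2 power2_eq_square)
    have "(- ((- 1) ^ s * (gen_harm s j - x)))\<^sup>2 * ((- 1) ^ r * y) = - ((gen_harm s j - x)\<^sup>2 * y)"
      using \<open>odd r\<close> by (simp add: power_mult_distrib power_mult[symmetric])
    also have "\<dots> = - ((gen_harm s j)\<^sup>2 * y) + (2 * (gen_harm s j * (x * y)) - x\<^sup>2 * y)"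
      by (simp add: power2_eq_square algebra_simps)
    finally show "(- ((- 1) ^ s * (gen_harm s j - 1 / of_nat j ^ s)))\<^sup>2 * ((- 1) ^ r * (1 / of_nat j ^ r))
        = - ((gen_harm s j)\<^sup>2 / of_nat j ^ r)
                      + (2 * (gen_harm s j / of_nat j ^ (r + s)) - 1 / of_nat j ^ (2 * s + r))"
      unfolding xy(1)[symmetric] xy(2)[symmetric] by (simp add: x_def y_def)
  qed
  also have "\<dots> = - ?S + (2 * ?D - ?T)"
    by (simp only: sum.distrib sum_subtractf sum_negf sum_distrib_left)
  finally have "2 * ?S \<equiv>\<^sub>p 2 * ?D - ?T" by (rule rat_cong_move)
  also have "\<dots> \<equiv>\<^sub>p 2 * ?D - 0"
    by (intro rat_cong_diff rat_cong_refl inverse_power_sum_cong assms integral_at_mult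
        integral_at_numeral integral_at_harmonic_double_sum)
  finally show ?thesis using rat_cong_halve[OF assms(1)] by simp
qed

text \<open>The cubes of the harmonic numbers telescope to the cube of the complete sum, which vanishes modulo
  \<open>p\<close>. With \<open>x = 1 / j\<^sup>s\<close>, the difference of two consecutive cubes is \<open>3 H\<^sup>2 x - 3 H x\<^sup>2 + x\<^sup>3\<close>, and
  the sum of the \<open>x\<^sup>3\<close> vanishes as well.\<close>

lemma square_sum_cong_double_sum_diagonal:
  assumes "p \<noteq> 3" "\<not> (p - 1) dvd 3 * s"
  shows "(\<Sum>j=1..p-1. (gen_harm s j)\<^sup>2 / of_nat j ^ s) \<equiv>\<^sub>p (\<Sum>j=1..p-1. gen_harm s j / of_nat j ^ (2 * s))"
    (is "?S \<equiv>\<^sub>p ?D")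
proof -
  let ?T = "\<Sum>j=1..p-1. 1 / of_nat j ^ (3 * s) :: rat"
  have telescope: "(\<Sum>j=1..n. (gen_harm s j) ^ 3 - (gen_harm s (j - 1)) ^ 3) = (gen_harm s n) ^ 3" for n
    by (induction n) (simp_all add: gen_harm_def[of _ 0])
  have "(gen_harm s (p - 1)) ^ 3 = (\<Sum>j=1..p-1. 3 * ((gen_harm s j)\<^sup>2 / of_nat j ^ s)
      - 3 * (gen_harm s j / of_nat j ^ (2 * s)) + 1 / of_nat j ^ (3 * s))"
  proof (subst telescope[symmetric], rule sum.cong[OF refl])
    fix j assume "j \<in> {1..p-1}"
    then have j: "j > 0" by auto
    define x where "x = (1 / of_nat j ^ s :: rat)"
    have x: "1 / of_nat j ^ (2 * s) = x\<^sup>2" "1 / of_nat j ^ (3 * s) = x ^ 3"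
      by (simp_all add: x_def power_divide power_mult[symmetric] mult.commute)
    have "(gen_harm s j) ^ 3 - (gen_harm s j - x) ^ 3 = 3 * ((gen_harm s j)\<^sup>2 * x) - 3 * (gen_harm s j * x\<^sup>2) + x ^ 3"
      by (simp add: algebra_simps power2_eq_square power3_eq_cube)
    then show "(gen_harm s j) ^ 3 - (gen_harm s (j - 1)) ^ 3
      = 3 * ((gen_harm s j)\<^sup>2 / of_nat j ^ s) - 3 * (gen_harm s j / of_nat j ^ (2 * s)) + 1 / of_nat j ^ (3 * s)"
      unfolding gen_harm_pred[OF j] x[symmetric] by (simp add: x_def)
  qed
  also have "\<dots> = 3 * ?S - 3 * ?D + ?T"
    by (simp only: sum.distrib sum_subtractf sum_distrib_left)
  finally have "3 * ?S = (gen_harm s (p - 1)) ^ 3 + 3 * ?D - ?T" by simp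
  also have "\<dots> \<equiv>\<^sub>p 0 ^ 3 + 3 * ?D - 0"
  proof (intro rat_cong_diff rat_cong_add rat_cong_power rat_cong_refl inverse_power_sum_cong assms integral_at_mult
        integral_at_numeral integral_at_harmonic_double_sum)
    have "\<not> (p - 1) dvd s" using assms(2) by (metis dvd_mult)
    then show "gen_harm s (p - 1) \<equiv>\<^sub>p 0" unfolding gen_harm_def by (rule inverse_power_sum_cong)
  qed
  finally have "of_nat 3 * ?S \<equiv>\<^sub>p of_nat 3 * ?D" by simp
  moreover have "\<not> p dvd 3"
    using p assms(1) primes_dvd_imp_eq[of p 3] by (auto simp: prime_nat_numeral_eq)
  ultimately show ?thesis by (rule rat_cong_cancel_of_nat)
qed

text \<open>For even \<open>s\<close>, reflection changes \<open>H\<^sub>j\<close> into \<open>1 / j\<^sup>s - H\<^sub>j\<close> and fixes the other factor, so \<open>D\<close> is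
  congruent to \<open>- D\<close> plus the complete sum with exponent \<open>3 s\<close>.\<close>

lemma double_sum_cong_0:
  assumes "p \<noteq> 2" "\<not> (p - 1) dvd 3 * s" "even s"
  shows "(\<Sum>j=1..p-1. gen_harm s j / of_nat j ^ (2 * s)) \<equiv>\<^sub>p 0" (is "?D \<equiv>\<^sub>p 0")
proof -
  let ?T = "\<Sum>j=1..p-1. 1 / of_nat j ^ (3 * s) :: rat"
  have s: "\<not> (p - 1) dvd s" using assms(2) by (metis dvd_mult)
  have "?D = (\<Sum>j=1..p-1. gen_harm s (p - j) * (1 / of_nat (p - j) ^ (2 * s)))"
    by (subst sum_reflect) simp
  also have "\<dots> \<equiv>\<^sub>p (\<Sum>j=1..p-1. - ((- 1) ^ s * (gen_harm s j - 1 / of_nat j ^ s))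
                          * ((- 1) ^ (2 * s) * (1 / of_nat j ^ (2 * s))))"
    by (intro rat_cong_sum rat_cong_mult gen_harm_reflect_pred inverse_power_reflect s)
  also have "\<dots> = (\<Sum>j=1..p-1. - (gen_harm s j / of_nat j ^ (2 * s)) + 1 / of_nat j ^ (3 * s))"
  proof (rule sum.cong[OF refl])
    fix j
    have "1 / of_nat j ^ s * (1 / of_nat j ^ (2 * s)) = (1 / of_nat j ^ (3 * s) :: rat)"
      by (simp add: power_add[symmetric])
    then show "- ((- 1) ^ s * (gen_harm s j - 1 / of_nat j ^ s)) * ((- 1) ^ (2 * s) * (1 / of_nat j ^ (2 * s)))
      = - (gen_harm s j / of_nat j ^ (2 * s)) + 1 / of_nat j ^ (3 * s)"
      using \<open>even s\<close> by (simp add: diff_divide_distrib)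
  qed
  also have "\<dots> = - ?D + ?T"
    by (simp only: sum.distrib sum_negf)
  finally have "2 * ?D \<equiv>\<^sub>p ?T" by (rule rat_cong_move)
  also have "?T \<equiv>\<^sub>p 0" by (rule inverse_power_sum_cong[OF assms(2)])
  finally show ?thesis using rat_cong_halve[OF assms(1), of ?D 0] by simp
qed

text \<open>Both \<open>p\<close> and \<open>2 s + r\<close> are odd, so \<open>2 s + r < p\<close> improves to \<open>2 s + r < p - 1\<close>, which is what
  the evaluation of \<open>D(s, r + s)\<close> requires.\<close>

lemma harmonic_square_sum_odd:
  assumes "1 \<le> s" "odd r" "2 * s + r < p"
  shows "(\<Sum>j=1..p-1. (gen_harm s j)\<^sup>2 / of_nat j ^ r)
    \<equiv>\<^sub>p (- 1) ^ (s + r) * of_nat ((2 * s + r) choose s) * (bernoulli_num (p - 2 * s - r) / of_nat (2 * s + r))"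
proof -
  have "p \<noteq> 2" using assms by auto
  then have "odd p" using p primes_dvd_imp_eq two_is_prime_nat by blast
  then have lt: "2 * s + r < p - 1"
    using assms by presburger
  then have "\<not> (p - 1) dvd s" "\<not> (p - 1) dvd 2 * s + r"
    using assms by (auto dest: dvd_imp_le)
  then have "(\<Sum>j=1..p-1. (gen_harm s j)\<^sup>2 / of_nat j ^ r) \<equiv>\<^sub>p (\<Sum>j=1..p-1. gen_harm s j / of_nat j ^ (r + s))"
    using \<open>p \<noteq> 2\<close> assms by (intro square_sum_cong_double_sum_odd)
  also have "\<dots> \<equiv>\<^sub>p (- 1) ^ (r + s) * of_nat ((s + (r + s)) choose s)
                    * (bernoulli_num (p - s - (r + s)) / of_nat (s + (r + s)))"
    using assms lt by (intro harmonic_double_sum) auto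
  finally have "(\<Sum>j=1..p-1. (gen_harm s j)\<^sup>2 / of_nat j ^ r) \<equiv>\<^sub>p \<dots>" .
  moreover have "s + (r + s) = 2 * s + r" "p - s - (r + s) = p - 2 * s - r"
      "(- 1) ^ (r + s) = ((- 1) ^ (s + r) :: rat)"
    by (simp_all add: add.commute)
  ultimately show ?thesis by (simp only:)
qed

text \<open>As \<open>p \<noteq> 3\<close> is prime and \<open>p - 1\<close> does not divide \<open>3 s\<close>, neither \<open>3 s = p\<close> nor \<open>3 s = p - 1\<close> is
  possible, and \<open>D(s, 2 s)\<close> can be evaluated for either parity of \<open>s\<close>.\<close>

lemma harmonic_square_sum_diagonal:
  assumes "1 \<le> s" "p \<noteq> 3" "\<not> (p - 1) dvd 3 * s" "3 * s \<le> p"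
  shows "(\<Sum>j=1..p-1. (gen_harm s j)\<^sup>2 / of_nat j ^ s)
    \<equiv>\<^sub>p of_nat ((3 * s) choose s) * (bernoulli_num (p - 3 * s) / of_nat (3 * s))"
proof -
  have "3 * s \<noteq> p"
    using p assms(2) by (metis dvd_triv_left prime_nat_iff numeral_eq_one_iff semiring_norm(86))
  moreover have "3 * s \<noteq> p - 1" using assms(3) by auto
  ultimately have lt: "3 * s < p - 1" using assms(4) by simp
  have "(\<Sum>j=1..p-1. (gen_harm s j)\<^sup>2 / of_nat j ^ s) \<equiv>\<^sub>p (\<Sum>j=1..p-1. gen_harm s j / of_nat j ^ (2 * s))"
    by (rule square_sum_cong_double_sum_diagonal) fact+
  also have "\<dots> \<equiv>\<^sub>p (- 1) ^ (2 * s) * of_nat ((s + 2 * s) choose s)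
                    * (bernoulli_num (p - s - 2 * s) / of_nat (s + 2 * s))"
    using assms lt by (intro harmonic_double_sum) auto
  finally show ?thesis by simp
qed

lemma harmonic_square_sum_even:
  assumes "3 \<le> p" "\<not> (p - 1) dvd 3 * s" "even s"
  shows "(\<Sum>j=1..p-1. (gen_harm s j)\<^sup>2 / of_nat j ^ s) \<equiv>\<^sub>p 0"
proof -
  have "p \<noteq> 3" "p \<noteq> 2" using assms by auto
  then show ?thesis
    using assms
    by (intro rat_cong_trans[OF square_sum_cong_double_sum_diagonal double_sum_cong_0])
qed

end

text \<open>For \<open>p = 3\<close> and \<open>s = 1\<close> the factor \<open>1 / (3 s)\<close> is not \<open>p\<close>-integral, but the binomial
  coefficient cancels it: the right-hand side is \<open>1\<close>, and the left-hand side is \<open>17 / 8\<close>.\<close>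

lemma harmonic_square_sum_mod_3:
  "rat_cong 3 (\<Sum>j=1..3-1. (gen_harm 1 j)\<^sup>2 / of_nat j ^ 1)
     (of_nat ((3 * 1) choose 1) * (bernoulli_num (3 - 3 * 1) / of_nat (3 * 1)))"
proof -
  have three: "prime (3 :: nat)" by simp
  have lhs: "(\<Sum>j=1..3-1. (gen_harm 1 j)\<^sup>2 / of_nat j ^ 1) = 1 + of_nat 3 * (3 / of_nat 8)"
    by (simp add: gen_harm_def numeral_2_eq_2 power2_eq_square)
  have rhs: "of_nat ((3 * 1) choose 1) * (bernoulli_num (3 - 3 * 1) / of_nat (3 * 1)) = 1"
    by (simp add: bernoulli_num.simps)
  have "integral_at 3 (3 / of_nat 8)"
    by (rule integral_at_divide_of_nat[OF three integral_at_numeral[OF three]]) simp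
  then show ?thesis unfolding lhs rhs
    by (intro rat_congI[OF three integral_at_1[OF three] _ refl])
qed

theorem corollary2p2p1:
  shows
    "(\<forall>s r p :: nat. 1 \<le> s \<longrightarrow> odd r \<longrightarrow> prime p \<longrightarrow> p > 2 * s + r \<longrightarrow>
        rat_cong p
          (\<Sum>j=1..p-1. (gen_harm s j)^2 / of_nat j ^ r)
          ((-1) ^ (s + r) * of_nat ((2 * s + r) choose s)
             * (bernoulli_num (p - 2 * s - r) / of_nat (2 * s + r))))
     \<and> (\<forall>s p :: nat. 1 \<le> s \<longrightarrow> prime p \<longrightarrow> 3 \<le> p \<longrightarrow> \<not> (p - 1) dvd 3 * s \<longrightarrow> 3 * s \<le> p \<longrightarrow>
        rat_cong p
          (\<Sum>j=1..p-1. (gen_harm s j)^2 / of_nat j ^ s)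
          (of_nat ((3 * s) choose s) * (bernoulli_num (p - 3 * s) / of_nat (3 * s))))
     \<and> (\<forall>s p :: nat. 1 \<le> s \<longrightarrow> prime p \<longrightarrow> 3 * s + 3 \<le> p \<longrightarrow> \<not> (p - 1) dvd 3 * s)
     \<and> (\<forall>s p :: nat. 1 \<le> s \<longrightarrow> prime p \<longrightarrow> 3 \<le> p \<longrightarrow> \<not> (p - 1) dvd 3 * s \<longrightarrow> even s \<longrightarrow>
        rat_cong p (\<Sum>j=1..p-1. (gen_harm s j)^2 / of_nat j ^ s) 0)"
proof (intro conjI allI impI)
  fix s r p :: nat
  assume "1 \<le> s" "odd r" "prime p" "p > 2 * s + r"
  then show "rat_cong p (\<Sum>j=1..p-1. (gen_harm s j)^2 / of_nat j ^ r)
      ((-1) ^ (s + r) * of_nat ((2 * s + r) choose s)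
         * (bernoulli_num (p - 2 * s - r) / of_nat (2 * s + r)))"
    by (intro harmonic_square_sum_odd)
next
  fix s p :: nat
  assume *: "1 \<le> s" "prime p" "3 \<le> p" "\<not> (p - 1) dvd 3 * s" "3 * s \<le> p"
  show "rat_cong p (\<Sum>j=1..p-1. (gen_harm s j)^2 / of_nat j ^ s)
      (of_nat ((3 * s) choose s) * (bernoulli_num (p - 3 * s) / of_nat (3 * s)))"
  proof (cases "p = 3")
    case True
    then have "s = 1" using * by auto
    then show ?thesis using harmonic_square_sum_mod_3 unfolding True by simp
  next
    case False
    then show ?thesis using * by (intro harmonic_square_sum_diagonal)
  qed
next
  fix s p :: nat
  assume "1 \<le> s" "prime p" "3 * s + 3 \<le> p"
  then show "\<not> (p - 1) dvd 3 * s" by (auto dest: dvd_imp_le)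
next
  fix s p :: nat
  assume "1 \<le> s" "prime p" "3 \<le> p" "\<not> (p - 1) dvd 3 * s" "even s"
  then show "rat_cong p (\<Sum>j=1..p-1. (gen_harm s j)^2 / of_nat j ^ s) 0"
    by (intro harmonic_square_sum_even)
qed

end
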